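(* Let $X\subset\mathbb{P}^4$ be a quintic threefold whose equation, up to a coordinate transformation, is of the form $x_0x_1x_2x_3x_4$. Then $X$ has a closed orbit.
   Context: $SL(5,\mathbb{C})$ acts on the space $V=\mathrm{Sym}^5(\mathbb{C}^5)$ of quintic forms in $x_0,\dots,x_4$ by change of coordinates. "$X$ has a closed orbit" means that the $SL(5,\mathbb{C})$-orbit of its equation is closed in $V$. *)

theory Defs
  imports "HOL-Analysis.Analysis" "HOL-Library.Poly_Mapping"
begin

text \<open>
  Multivariate polynomials over \<open>'a\<close> with variables in \<open>'v\<close> are finitely supported maps from
  monomials (finitely supported exponent vectors) to coefficients; the convolution product of
  \<^theory>\<open>HOL-Library.Poly_Mapping\<close> is the product of polynomials.
\<close>

type_synonym ('v, 'a) mpoly = "('v \<Rightarrow>\<^sub>0 nat) \<Rightarrow>\<^sub>0 'a"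

definition Var :: "'v \<Rightarrow> ('v, 'a::comm_semiring_1) mpoly" where
  "Var i = Poly_Mapping.single (Poly_Mapping.single i 1) 1"

definition Const :: "'a::comm_semiring_1 \<Rightarrow> ('v, 'a) mpoly" where
  "Const c = Poly_Mapping.single 0 c"

text \<open>Evaluation at \<open>x\<close> in an algebra \<open>'b\<close> whose structure map is \<open>\<phi>\<close>.\<close>

definition eval_mpoly ::
    "('a::comm_semiring_1 \<Rightarrow> 'b::comm_semiring_1) \<Rightarrow> ('v \<Rightarrow> 'b) \<Rightarrow> ('v, 'a) mpoly \<Rightarrow> 'b" where
  "eval_mpoly \<phi> x p =
     (\<Sum>m\<in>Poly_Mapping.keys p.
        \<phi> (Poly_Mapping.lookup p m) *
        (\<Prod>i\<in>Poly_Mapping.keys m. x i ^ Poly_Mapping.lookup m i))"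

text \<open>
  The index type \<open>5\<close> has the elements 0, 1, 2, 3, 4, so \<open>Var 0, \<dots>, Var 4\<close> are the coordinates.
\<close>

type_synonym form5 = "(5, complex) mpoly"

definition quintic_forms :: "form5 set" where
  "quintic_forms =
     {f. \<forall>m\<in>Poly_Mapping.keys f. (\<Sum>i\<in>UNIV. Poly_Mapping.lookup m i) = 5}"

text \<open>
  The coordinate change \<open>x\<^sub>j \<mapsto> \<Sum>\<^sub>i A\<^sub>i\<^sub>j x\<^sub>i\<close>. Taking the columns of \<open>A\<close> makes this a left action, the one
  induced on polynomials by the standard representation with basis \<open>x\<^sub>0, \<dots>, x\<^sub>4\<close>.
  Orbits would be the same with \<open>A\<close> replaced by its transpose or its inverse.
\<close>

definition act :: "complex^5^5 \<Rightarrow> form5 \<Rightarrow> form5" where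
  "act A f = eval_mpoly Const (\<lambda>j. \<Sum>i\<in>UNIV. Const (A $ i $ j) * Var i) f"

definition SL_orbit :: "form5 \<Rightarrow> form5 set" where
  "SL_orbit f = {act A f | A. det A = 1}"

text \<open>
  The Zariski topology of the affine space of quintic forms. The coordinates on this space are the
  coefficients, so a polynomial function is a polynomial in variables indexed by monomials,
  evaluated at the coefficients of the form. Variables belonging to monomials of degree other than
  five are harmless, as those coefficients vanish on \<^const>\<open>quintic_forms\<close>.
\<close>

definition zariski_closed_in_quintics :: "form5 set \<Rightarrow> bool" where
  "zariski_closed_in_quintics Z \<longleftrightarrow>
     (\<exists>S :: (5 \<Rightarrow>\<^sub>0 nat, complex) mpoly set.
        Z = {f \<in> quintic_forms. \<forall>P\<in>S. eval_mpoly id (Poly_Mapping.lookup f) P = 0})"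

definition has_closed_orbit :: "form5 \<Rightarrow> bool" where
  "has_closed_orbit f \<longleftrightarrow> zariski_closed_in_quintics (SL_orbit f)"

end

theory Submission
  imports Defs "Jordan_Normal_Form.Determinant"
    "HOL-Computational_Algebra.Fundamental_Theorem_Algebra"
begin

text \<open>
  The orbit consists of the products \<open>l\<^sub>0 \<cdots> l\<^sub>4\<close> of linear forms with a fixed determinant
  \<open>det l = \<delta> \<noteq> 0\<close>. Equivalently, \<open>F\<close> is in the orbit iff \<open>det l * F = \<delta> * l\<^sub>0 \<cdots> l\<^sub>4\<close> for some
  nonzero linear forms: the right-hand side is then not zero, so \<open>det l \<noteq> 0\<close>, and rescaling
  \<open>l\<^sub>0\<close> makes the determinant equal to \<open>\<delta>\<close>. This condition is homogeneous in each \<open>l\<^sub>j\<close>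
  separately, so it describes the projection of a closed subset of an affine space times a product of
  five projective spaces, which is closed by the main theorem of elimination theory.
\<close>

subsection \<open>Polynomial functions\<close>

text \<open>Working with functions instead of elements of \<open>mpoly\<close> makes substitution
  plain composition and allows induction on how the function is built. The index type may be
  infinite. \<open>polyfun_imp_mpoly\<close> leads back to \<open>mpoly\<close>.\<close>

inductive polyfun :: "(('a \<Rightarrow> complex) \<Rightarrow> complex) \<Rightarrow> bool" where
  const: "polyfun (\<lambda>_. c)"
| var: "polyfun (\<lambda>w. w i)"
| add: "polyfun f \<Longrightarrow> polyfun g \<Longrightarrow> polyfun (\<lambda>w. f w + g w)"
| mult: "polyfun f \<Longrightarrow> polyfun g \<Longrightarrow> polyfun (\<lambda>w. f w * g w)"

lemma polyfun_sum: "(\<And>i. i \<in> A \<Longrightarrow> polyfun (f i)) \<Longrightarrow> polyfun (\<lambda>w. \<Sum>i\<in>A. f i w)"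
  by (induction A rule: infinite_finite_induct) (simp_all add: polyfun.const polyfun.add)

lemma polyfun_prod: "(\<And>i. i \<in> A \<Longrightarrow> polyfun (f i)) \<Longrightarrow> polyfun (\<lambda>w. \<Prod>i\<in>A. f i w)"
  by (induction A rule: infinite_finite_induct) (simp_all add: polyfun.const polyfun.mult)

lemma polyfun_if: "polyfun f \<Longrightarrow> polyfun g \<Longrightarrow> polyfun (\<lambda>w. if b then f w else g w)"
  by (cases b) auto

lemma polyfun_compose:
  assumes "polyfun f" "\<And>i. polyfun (\<lambda>w. g w i)"
  shows "polyfun (\<lambda>w. f (g w))"
  using assms(1) by induction (simp_all add: polyfun.const polyfun.add polyfun.mult assms(2))

lemma polyfun_poly: "polyfun f \<Longrightarrow> polyfun (\<lambda>w. poly q (f w))"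
  by (induction q) (simp_all add: polyfun.const polyfun.add polyfun.mult)

section \<open>Functions homogeneous in a chosen set of variables\<close>

definition rescale :: "'a set \<Rightarrow> complex \<Rightarrow> ('a \<Rightarrow> complex) \<Rightarrow> 'a \<Rightarrow> complex" where
  "rescale J t w = (\<lambda>i. if i \<in> J then t * w i else w i)"

lemma polyfun_rescale: "polyfun f \<Longrightarrow> polyfun (\<lambda>w. f (rescale J t w))"
  by (erule polyfun_compose)
    (simp add: rescale_def polyfun_if polyfun.var polyfun.mult[OF polyfun.const polyfun.var])

text \<open>Homogeneous of degree \<open>d\<close> in the variables of \<open>J\<close>, with
  coefficients polynomial in the remaining ones. The rule \<open>zero\<close> puts the zero function
  in every degree, so that missing components need no special treatment.\<close>

inductive hpoly :: "'a set \<Rightarrow> nat \<Rightarrow> (('a \<Rightarrow> complex) \<Rightarrow> complex) \<Rightarrow> bool" for J where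
  const: "hpoly J 0 (\<lambda>_. c)"
| zero: "hpoly J d (\<lambda>_. 0)"
| outside: "i \<notin> J \<Longrightarrow> hpoly J 0 (\<lambda>w. w i)"
| inside: "i \<in> J \<Longrightarrow> hpoly J 1 (\<lambda>w. w i)"
| add: "hpoly J d f \<Longrightarrow> hpoly J d g \<Longrightarrow> hpoly J d (\<lambda>w. f w + g w)"
| mult: "hpoly J d f \<Longrightarrow> hpoly J e g \<Longrightarrow> hpoly J (d + e) (\<lambda>w. f w * g w)"

lemma hpoly_polyfun: "hpoly J d f \<Longrightarrow> polyfun f"
  by (induction rule: hpoly.induct) (simp_all add: polyfun.intros)

lemma hpoly_sum: "(\<And>i. i \<in> A \<Longrightarrow> hpoly J d (f i)) \<Longrightarrow> hpoly J d (\<lambda>w. \<Sum>i\<in>A. f i w)"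
  by (induction A rule: infinite_finite_induct) (simp_all add: hpoly.zero hpoly.add)

lemma hpoly_rescale: "hpoly J d f \<Longrightarrow> f (rescale J t w) = t ^ d * f w"
  by (induction rule: hpoly.induct) (auto simp: rescale_def algebra_simps power_add)

text \<open>Rescaling by 0 erases the variables in \<open>J\<close>, and a function of degree 0 does
  not notice it, because \<open>0 ^ 0 = 1\<close>.\<close>

lemma hpoly_0_cong:
  assumes "hpoly J 0 f" "\<And>i. i \<notin> J \<Longrightarrow> w i = w' i"
  shows "f w = f w'"
proof -
  have "rescale J 0 w = rescale J 0 w'"
    using assms(2) by (auto simp: rescale_def)
  then show ?thesis
    using hpoly_rescale[OF assms(1), of 0 w] hpoly_rescale[OF assms(1), of 0 w'] by simp
qed

text \<open>Homogeneous components add termwise and multiply by the Cauchy product. The clause on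
  \<open>k > N\<close> is carried along so that sums can be extended to a common bound.\<close>

lemma polyfun_hpoly_decomp:
  assumes "polyfun f"
  shows "\<exists>N c. (\<forall>k. hpoly J k (c k)) \<and> (\<forall>k>N. c k = (\<lambda>_. 0)) \<and> f = (\<lambda>w. \<Sum>k\<le>N. c k w)"
  using assms
proof induction
  case (const a)
  show ?case
    by (rule exI[of _ 0], rule exI[of _ "\<lambda>k. if k = 0 then (\<lambda>_. a) else (\<lambda>_. 0)"])
      (auto intro: hpoly.const hpoly.zero hpoly.outside)
next
  case (var i)
  show ?case
  proof (cases "i \<in> J")
    case True
    then show ?thesis
      by (intro exI[of _ 1] exI[of _ "\<lambda>k. if k = 1 then (\<lambda>w. w i) else (\<lambda>_. 0)"])
        (auto intro: hpoly.const hpoly.zero hpoly.inside[simplified])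
  next
    case False
    then show ?thesis
      by (intro exI[of _ 0] exI[of _ "\<lambda>k. if k = 0 then (\<lambda>w. w i) else (\<lambda>_. 0)"])
        (auto intro: hpoly.const hpoly.zero hpoly.outside)
  qed
next
  case (add f g)
  from add.IH(1) obtain N a where
    a: "\<forall>k. hpoly J k (a k)" "\<forall>k>N. a k = (\<lambda>_. 0)" "f = (\<lambda>w. \<Sum>k\<le>N. a k w)"
    by blast
  from add.IH(2) obtain M b where
    b: "\<forall>k. hpoly J k (b k)" "\<forall>k>M. b k = (\<lambda>_. 0)" "g = (\<lambda>w. \<Sum>k\<le>M. b k w)"
    by blast
  note a = a(1,2)[rule_format] a(3) and b = b(1,2)[rule_format] b(3)
  have a0: "k \<le> N" if "a k w \<noteq> 0" for k w
    using a(2)[of k] that by (cases "k \<le> N") auto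
  have b0: "k \<le> M" if "b k w \<noteq> 0" for k w
    using b(2)[of k] that by (cases "k \<le> M") auto
  have "(\<Sum>k\<le>N. a k w) = (\<Sum>k\<le>N+M. a k w)" "(\<Sum>k\<le>M. b k w) = (\<Sum>k\<le>N+M. b k w)" for w
    using a0 b0 by (auto intro!: sum.mono_neutral_left)
  then have "(\<lambda>w. f w + g w) = (\<lambda>w. \<Sum>k\<le>N+M. a k w + b k w)"
    unfolding a(3) b(3) by (simp add: sum.distrib)
  then show ?case
    using hpoly.add[OF a(1) b(1)] a(2) b(2)
    by (intro exI[of _ "N + M"] exI[of _ "\<lambda>k w. a k w + b k w"]) simp
next
  case (mult f g)
  from mult.IH(1) obtain N a where
    a: "\<forall>k. hpoly J k (a k)" "\<forall>k>N. a k = (\<lambda>_. 0)" "f = (\<lambda>w. \<Sum>k\<le>N. a k w)"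
    by blast
  from mult.IH(2) obtain M b where
    b: "\<forall>k. hpoly J k (b k)" "\<forall>k>M. b k = (\<lambda>_. 0)" "g = (\<lambda>w. \<Sum>k\<le>M. b k w)"
    by blast
  note a = a(1,2)[rule_format] a(3) and b = b(1,2)[rule_format] b(3)
  define c where "c = (\<lambda>r w. \<Sum>k\<le>r. a k w * b (r - k) w)"
  have "hpoly J r (c r)" for r
    unfolding c_def
  proof (rule hpoly_sum)
    fix k assume "k \<in> {..r}"
    then show "hpoly J r (\<lambda>w. a k w * b (r - k) w)"
      using hpoly.mult[OF a(1) b(1), of k "r - k"] by simp
  qed
  moreover have "c r = (\<lambda>_. 0)" if "r > N + M" for r
  proof -
    have "a k w * b (r - k) w = 0" for k w
      using that by (cases "k > N") (auto simp: a(2) b(2))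
    then show ?thesis
      unfolding c_def by (intro ext sum.neutral ballI)
  qed
  moreover have "f w * g w = (\<Sum>r\<le>N+M. c r w)" for w
    \<comment> \<open>The values of the components are taken as coefficients of univariate
      polynomials, which are multiplied and evaluated at 1.\<close>
    using polynomial_product[of N "\<lambda>k. a k w" M "\<lambda>k. b k w" 1]
    by (simp add: a(2,3) b(2,3) c_def)
  ultimately show ?case
    by blast
qed

text \<open>Expansion in powers of \<open>w j\<close>. The independence of \<open>c k\<close> from
  \<open>w j\<close> is a clause of its own, since \<open>hpoly (J - {j})\<close> treats
  \<open>w j\<close> as an outside variable and so permits it. The coefficient \<open>c d\<close>
  has degree 0.\<close>

lemma hpoly_expand:
  assumes "hpoly J d f" "j \<in> J"
  shows "\<exists>c. (\<forall>k\<le>d. hpoly (J - {j}) (d - k) (c k)) \<and> (\<forall>k>d. c k = (\<lambda>_. 0)) \<and>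
    (\<forall>k w t. c k (w(j := t)) = c k w) \<and> f = (\<lambda>w. \<Sum>k\<le>d. c k w * w j ^ k)"
  using assms(1)
proof induction
  case (const a)
  show ?case
    by (rule exI[of _ "\<lambda>k. if k = 0 then (\<lambda>_. a) else (\<lambda>_. 0)"])
      (auto intro: hpoly.const hpoly.zero hpoly.outside)
next
  case (zero d)
  show ?case
    by (rule exI[of _ "\<lambda>k _. 0"])
      (auto intro: hpoly.const hpoly.zero hpoly.outside)
next
  case (outside i)
  then show ?case
    using assms(2)
    by (intro exI[of _ "\<lambda>k. if k = 0 then (\<lambda>w. w i) else (\<lambda>_. 0)"])
      (auto intro: hpoly.const hpoly.zero hpoly.outside)
next
  case (inside i)
  show ?case
  proof (cases "i = j")
    case True
    then show ?thesis
      by (intro exI[of _ "\<lambda>k. if k = 1 then (\<lambda>w. 1) else (\<lambda>_. 0)"])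
        (auto intro: hpoly.const hpoly.zero hpoly.outside)
  next
    case False
    then show ?thesis
      using inside
      by (intro exI[of _ "\<lambda>k. if k = 0 then (\<lambda>w. w i) else (\<lambda>_. 0)"])
        (auto intro: hpoly.const hpoly.zero hpoly.inside[simplified])
  qed
next
  case (add d f g)
  from add.IH(1) obtain a where
    a: "\<forall>k\<le>d. hpoly (J - {j}) (d - k) (a k)" "\<forall>k>d. a k = (\<lambda>_. 0)"
      "\<forall>k w t. a k (w(j := t)) = a k w" "f = (\<lambda>w. \<Sum>k\<le>d. a k w * w j ^ k)"
    by blast
  from add.IH(2) obtain b where
    b: "\<forall>k\<le>d. hpoly (J - {j}) (d - k) (b k)" "\<forall>k>d. b k = (\<lambda>_. 0)"
      "\<forall>k w t. b k (w(j := t)) = b k w" "g = (\<lambda>w. \<Sum>k\<le>d. b k w * w j ^ k)"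
    by blast
  note a = a(1,2,3)[rule_format] a(4) and b = b(1,2,3)[rule_format] b(4)
  have "(\<lambda>w. f w + g w) = (\<lambda>w. \<Sum>k\<le>d. (a k w + b k w) * w j ^ k)"
    unfolding a(4) b(4) by (simp add: sum.distrib distrib_right)
  then show ?case
    using hpoly.add[OF a(1) b(1)] a(2,3) b(2,3)
    by (intro exI[of _ "\<lambda>k w. a k w + b k w"]) (simp del: fun_upd_apply)
next
  case (mult d f e g)
  from mult.IH(1) obtain a where
    a: "\<forall>k\<le>d. hpoly (J - {j}) (d - k) (a k)" "\<forall>k>d. a k = (\<lambda>_. 0)"
      "\<forall>k w t. a k (w(j := t)) = a k w" "f = (\<lambda>w. \<Sum>k\<le>d. a k w * w j ^ k)"
    by blast
  from mult.IH(2) obtain b where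
    b: "\<forall>k\<le>e. hpoly (J - {j}) (e - k) (b k)" "\<forall>k>e. b k = (\<lambda>_. 0)"
      "\<forall>k w t. b k (w(j := t)) = b k w" "g = (\<lambda>w. \<Sum>k\<le>e. b k w * w j ^ k)"
    by blast
  note a = a(1,2,3)[rule_format] a(4) and b = b(1,2,3)[rule_format] b(4)
  define c where "c = (\<lambda>r w. \<Sum>k\<le>r. a k w * b (r - k) w)"
  have 1: "hpoly (J - {j}) (d + e - r) (c r)" if "r \<le> d + e" for r
    unfolding c_def
  proof (intro hpoly_sum)
    fix k assume k: "k \<in> {..r}"
    show "hpoly (J - {j}) (d + e - r) (\<lambda>w. a k w * b (r - k) w)"
    proof (cases "k \<le> d \<and> r - k \<le> e")
      case True
      then have "(d - k) + (e - (r - k)) = d + e - r"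
        using k by auto
      then show ?thesis
        using hpoly.mult[OF a(1) b(1), of k "r - k"] True by simp
    next
      \<comment> \<open>One of the two factors is zero here, whereas truncated subtraction would
        spoil the degree count.\<close>
      case False
      then have "(\<lambda>w. a k w * b (r - k) w) = (\<lambda>_. 0)"
        using a(2)[of k] b(2)[of "r - k"] by force
      then show ?thesis
        by (simp add: hpoly.zero)
    qed
  qed
  have 2: "c r = (\<lambda>_. 0)" if "r > d + e" for r
  proof -
    have "a k w * b (r - k) w = 0" for k w
      using that by (cases "k > d") (auto simp: a(2) b(2))
    then show ?thesis
      unfolding c_def by (intro ext sum.neutral ballI)
  qed
  have 3: "c r (w(j := t)) = c r w" for r w t
    by (simp add: c_def a(3) b(3))
  have 4: "(\<lambda>w. f w * g w) = (\<lambda>w. \<Sum>r\<le>d+e. c r w * w j ^ r)"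
  proof
    fix w
    show "f w * g w = (\<Sum>r\<le>d+e. c r w * w j ^ r)"
      unfolding a(4) b(4) c_def
      by (rule polynomial_product) (simp_all add: a(2) b(2))
  qed
  show ?case
    by (intro exI[of _ c] conjI allI impI 1 2 3 4)
qed

text \<open>Decompose into components homogeneous in the single variable \<open>j\<close>; setting
  that variable to 1 in the component of degree \<open>k\<close> leaves the coefficient of
  \<open>w j ^ k\<close>.\<close>

lemma polyfun_expand:
  assumes "polyfun f"
  shows "\<exists>N c. (\<forall>k. polyfun (c k)) \<and> (\<forall>k w t. c k (w(j := t)) = c k w) \<and>
    f = (\<lambda>w. \<Sum>k\<le>N. c k w * w j ^ k)"
proof -
  from polyfun_hpoly_decomp[OF assms, of "{j}"] obtain N h where
    h: "\<forall>k. hpoly {j} k (h k)" "f = (\<lambda>w. \<Sum>k\<le>N. h k w)"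
    by blast
  note h = h(1)[rule_format] h(2)
  define c where "c = (\<lambda>k w. h k (w(j := 1)))"
  have "polyfun (c k)" for k
    unfolding c_def by (rule polyfun_compose[OF hpoly_polyfun[OF h(1)]])
      (simp add: fun_upd_def polyfun_if polyfun.var polyfun.const)
  moreover have "h k w = c k w * w j ^ k" for k w
  proof -
    have "rescale {j} (w j) (w(j := 1)) = w"
      by (auto simp: rescale_def)
    then show ?thesis
      using hpoly_rescale[OF h(1), of k "w j" "w(j := 1)"] by (simp add: c_def)
  qed
  then have "f = (\<lambda>w. \<Sum>k\<le>N. c k w * w j ^ k)"
    by (simp add: h(2))
  moreover have "c k (w(j := t)) = c k w" for k w t
    by (simp add: c_def)
  ultimately show ?thesis
    by (intro exI[of _ N] exI[of _ c] conjI allI)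
qed

section \<open>Resultants\<close>

text \<open>A row of the Sylvester matrix is a coefficient vector shifted by \<open>a\<close>;
  pairing it with the powers of \<open>t\<close> gives \<open>t ^ a\<close> times the value of the
  polynomial.\<close>

lemma sylvester_row:
  fixes f :: "nat \<Rightarrow> complex"
  assumes "a + m < n"
  shows "(\<Sum>k<n. (if a \<le> k \<and> k - a \<le> m then f (k - a) else 0) * t ^ k) = t ^ a * (\<Sum>l\<le>m. f l * t ^ l)"
proof -
  have "(\<Sum>k<n. (if a \<le> k \<and> k - a \<le> m then f (k - a) else 0) * t ^ k) =
      (\<Sum>k\<in>{0+a..m+a}. f (k - a) * t ^ k)"
    using assms by (intro sum.mono_neutral_cong_right) auto
  also have "\<dots> = (\<Sum>l\<in>{0..m}. f l * t ^ (l + a))"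
    by (subst sum.shift_bounds_cl_nat_ivl) simp
  finally show ?thesis
    by (simp add: sum_distrib_left power_add atMost_atLeast0 mult_ac)
qed

text \<open>\<open>R\<close> is the resultant for the formal degrees \<open>d\<close> and \<open>N\<close>: actual degrees may drop.\<close>

lemma polyfun_resultant:
  fixes c b :: "nat \<Rightarrow> ('a \<Rightarrow> complex) \<Rightarrow> complex"
  assumes c: "\<And>k. polyfun (c k)" and b: "\<And>k. polyfun (b k)" and "N > 0"
  shows "\<exists>R. polyfun R \<and>
    (\<forall>w t. (\<Sum>k\<le>d. c k w * t ^ k) = 0 \<longrightarrow> (\<Sum>k\<le>N. b k w * t ^ k) = 0 \<longrightarrow> R w = 0) \<and>
    (\<forall>w. b 0 w = 1 \<longrightarrow> (\<forall>k\<in>{1..N}. b k w = 0) \<longrightarrow> R w = c d w ^ N)"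
proof -
  define n where "n = d + N"
  \<comment> \<open>Sylvester matrix: \<open>d\<close> shifted rows of \<open>b\<close>, then
    \<open>N\<close> shifted rows of \<open>c\<close>.\<close>
  define S where "S = (\<lambda>w i k. if i < d then (if i \<le> k \<and> k - i \<le> N then b (k - i) w else 0)
     else (if i - d \<le> k \<and> k - (i - d) \<le> d then c (k - (i - d)) w else 0))"
  define A where "A = (\<lambda>w. mat n n (\<lambda>(i, k). S w i k))"
  define R where "R = (\<lambda>w. Determinant.det (A w))"
  have A[simp]: "A w \<in> carrier_mat n n" for w
    by (simp add: A_def)
  have "polyfun (\<lambda>w. S w i k)" for i k
    unfolding S_def by (intro polyfun_if c b polyfun.const)
  moreover have "R = (\<lambda>w. \<Sum>p | p permutes {0..<n}. signof p * (\<Prod>i = 0..<n. S w i (p i)))"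
    unfolding R_def det_def'[OF A]
    by (intro ext sum.cong refl arg_cong2[where f="(*)"] prod.cong)
      (auto simp: A_def permutes_in_image)
  ultimately have 1: "polyfun R"
    by (simp add: polyfun_sum polyfun_prod polyfun.const polyfun.mult)
  have 2: "R w = 0" if ct: "(\<Sum>k\<le>d. c k w * t ^ k) = 0" and bt: "(\<Sum>k\<le>N. b k w * t ^ k) = 0" for w t
  proof -
    \<comment> \<open>A common root makes the vector of its powers a kernel vector. It is nonzero
      because its entry at 0 is 1; this entry exists since \<open>N > 0\<close>.\<close>
    define v where "v = vec n (\<lambda>k. t ^ k)"
    have "(\<Sum>k<n. S w i k * t ^ k) = 0" if "i < n" for i
    proof (cases "i < d")
      case True
      then show ?thesis
        using sylvester_row[of i N n "\<lambda>k. b k w" t] bt by (simp add: S_def n_def)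
    next
      case False
      then show ?thesis
        using sylvester_row[of "i - d" d n "\<lambda>k. c k w" t] ct that by (simp add: S_def n_def)
    qed
    then have "A w *\<^sub>v v = 0\<^sub>v n"
      by (intro eq_vecI)
        (auto simp: A_def v_def scalar_prod_def lessThan_atLeast0 intro!: sum.cong)
    moreover have "vec_index v 0 \<noteq> vec_index (0\<^sub>v n) 0"
      using \<open>N > 0\<close> by (simp add: v_def n_def)
    then have "v \<noteq> 0\<^sub>v n"
      by metis
    moreover have "v \<in> carrier_vec n"
      by (simp add: v_def)
    ultimately show ?thesis
      unfolding R_def det_0_iff_vec_prod_zero_field[OF A] by blast
  qed
  have 3: "R w = c d w ^ N" if b0: "b 0 w = 1" and bk: "\<forall>k\<in>{1..N}. b k w = 0" for w
  proof -
    \<comment> \<open>If \<open>b\<close> is the constant 1, the matrix is lower triangular with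
      diagonal entries 1 (\<open>d\<close> times) and \<open>c d w\<close> (\<open>N\<close>
      times).\<close>
    have "R w = prod_list (diag_mat (A w))"
      unfolding R_def
    proof (rule det_lower_triangular[OF _ A])
      fix i k assume "i < k" "k < n"
      then show "A w $$ (i, k) = 0"
        using bk by (auto simp: A_def S_def)
    qed
    also have "\<dots> = (\<Prod>i=0..<n. S w i i)"
      by (simp add: prod_list_diag_prod A_def)
    also have "\<dots> = (\<Prod>i=0..<n. if i < d then 1 else c d w)"
      using b0 by (intro prod.cong) (auto simp: S_def)
    also have "\<dots> = (\<Prod>i\<in>{d..<n}. c d w)"
      by (intro prod.mono_neutral_cong_right) auto
    finally show ?thesis
      by (simp add: n_def)
  qed
  show ?thesis
    using 1 2 3 by blast
qed

hide_const (open) Determinant.det Matrix.mat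
no_notation vec_index (infixl "$" 100)

subsection \<open>Closed sets\<close>

definition vanishing :: "('a \<Rightarrow> complex) set \<Rightarrow> (('a \<Rightarrow> complex) \<Rightarrow> complex) set" where
  "vanishing S = {P. polyfun P \<and> (\<forall>u\<in>S. P u = 0)}"

definition zclosure :: "('a \<Rightarrow> complex) set \<Rightarrow> ('a \<Rightarrow> complex) set" where
  "zclosure S = {w. \<forall>P\<in>vanishing S. P w = 0}"

text \<open>Zariski closedness stated as separation of each outside point by one polynomial
  function, so that elimination can treat one point \<open>v\<close> at a time.\<close>

definition zclosed :: "('a \<Rightarrow> complex) set \<Rightarrow> bool" where
  "zclosed S \<longleftrightarrow> (\<forall>v. v \<notin> S \<longrightarrow> (\<exists>P\<in>vanishing S. P v \<noteq> 0))"

definition conic :: "'a set \<Rightarrow> ('a \<Rightarrow> complex) set \<Rightarrow> bool" where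
  "conic J Z \<longleftrightarrow> (\<forall>w\<in>Z. \<forall>t. rescale J t w \<in> Z)"

lemma zclosureD: "w \<in> zclosure S \<Longrightarrow> P \<in> vanishing S \<Longrightarrow> P w = 0"
  by (simp add: zclosure_def)

lemma zclosedD: "zclosed S \<Longrightarrow> v \<notin> S \<Longrightarrow> \<exists>P\<in>vanishing S. P v \<noteq> 0"
  by (simp add: zclosed_def)

lemma zclosed_zclosure: "zclosed (zclosure S)"
  unfolding zclosed_def zclosure_def vanishing_def by blast

lemma zclosure_superset: "S \<subseteq> zclosure S"
  by (auto simp: zclosure_def vanishing_def)

text \<open>Composition with a rescaling maps the vanishing ideal of a conic set into
  itself.\<close>

lemma conic_zclosure:
  assumes "conic J S"
  shows "conic J (zclosure S)"
  unfolding conic_def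
proof (intro ballI allI)
  fix w t assume w: "w \<in> zclosure S"
  show "rescale J t w \<in> zclosure S"
    unfolding zclosure_def
  proof (intro CollectI ballI)
    fix P assume P: "P \<in> vanishing S"
    then have "(\<lambda>w. P (rescale J t w)) \<in> vanishing S"
      using assms by (simp add: vanishing_def conic_def polyfun_rescale)
    from zclosureD[OF w this] show "P (rescale J t w) = 0" .
  qed
qed

text \<open>Along \<open>rescale J t u\<close> the function \<open>P\<close> is a polynomial in
  \<open>t\<close> whose coefficients are its homogeneous components at \<open>u\<close>. It is zero
  for all \<open>t\<close>, so each component vanishes on \<open>Z\<close>, and some component is
  nonzero at \<open>v\<close>.\<close>

lemma conic_vanishing_hpoly:
  assumes "conic J Z" "P \<in> vanishing Z" "P v \<noteq> 0"
  shows "\<exists>d h. hpoly J d h \<and> h \<in> vanishing Z \<and> h v \<noteq> 0"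
proof -
  have "polyfun P"
    using assms(2) by (simp add: vanishing_def)
  from polyfun_hpoly_decomp[OF this, of J] obtain N c where
    c: "\<forall>k. hpoly J k (c k)" "P = (\<lambda>w. \<Sum>k\<le>N. c k w)"
    by blast
  have "c k u = 0" if u: "u \<in> Z" and k: "k \<le> N" for u k
  proof -
    have "(\<Sum>k\<le>N. c k u * t ^ k) = 0" for t
    proof -
      have "rescale J t u \<in> Z"
        using assms(1) u by (simp add: conic_def)
      then have "P (rescale J t u) = 0"
        using assms(2) by (simp add: vanishing_def)
      then show ?thesis
        using hpoly_rescale[OF c(1)[rule_format]] by (simp add: c(2) mult.commute)
    qed
    then show ?thesis
      using polyfun_eq_0[of "\<lambda>k. c k u" N] k by blast
  qed
  moreover obtain k where "k \<le> N" "c k v \<noteq> 0"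
  proof -
    have "(\<Sum>k\<le>N. c k v) \<noteq> 0"
      using assms(3) by (simp add: c(2))
    from sum.not_neutral_contains_not_neutral[OF this] that show ?thesis
      by auto
  qed
  ultimately show ?thesis
    using hpoly_polyfun[OF c(1)[rule_format]] c(1)
    by (intro exI[of _ k] exI[of _ "c k"]) (simp add: vanishing_def)
qed

lemma polyfun_on_line:
  assumes "polyfun P"
  shows "\<exists>q. \<forall>t. P (w(j := t)) = poly q t"
proof -
  from polyfun_expand[OF assms, of j] obtain N c where
    c: "\<forall>k w t. c k (w(j := t)) = c k w" "P = (\<lambda>w. \<Sum>k\<le>N. c k w * w j ^ k)"
    by blast
  have "P (w(j := t)) = poly (\<Sum>k\<le>N. monom (c k w) k) t" for t
    by (simp add: c(2) c(1)[rule_format] poly_sum poly_monom del: fun_upd_apply)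
      (simp add: c)
  then show ?thesis
    by blast
qed

text \<open>The restrictions of the vanishing ideal to a line form an ideal of the principal ideal domain
  of univariate polynomials; if it has no zero, it is the unit ideal.\<close>

lemma vanishing_eq_1_on_line:
  assumes "\<And>t. \<exists>P\<in>vanishing Z. P (w(j := t)) \<noteq> 0"
  shows "\<exists>P\<in>vanishing Z. \<forall>t. P (w(j := t)) = 1"
proof -
  define I where "I = {q. \<exists>P\<in>vanishing Z. \<forall>t. P (w(j := t)) = poly q t}"
  have add: "q + r \<in> I" if qr: "q \<in> I" "r \<in> I" for q r
  proof -
    from qr obtain P Q where "P \<in> vanishing Z" "\<forall>t. P (w(j := t)) = poly q t"
      "Q \<in> vanishing Z" "\<forall>t. Q (w(j := t)) = poly r t"
      unfolding I_def by blast
    then show ?thesis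
      unfolding I_def vanishing_def
      by (intro CollectI bexI[of _ "\<lambda>w. P w + Q w"]) (simp_all add: polyfun.add)
  qed
  have mult: "r * q \<in> I" if q: "q \<in> I" for q r
  proof -
    from q obtain P where "P \<in> vanishing Z" "\<forall>t. P (w(j := t)) = poly q t"
      unfolding I_def by blast
    then show ?thesis
      unfolding I_def vanishing_def
      \<comment> \<open>The univariate multiplier \<open>r\<close> is lifted to a function of
        \<open>w j\<close>, which restricts to \<open>r\<close> on the line.\<close>
      by (intro CollectI bexI[of _ "\<lambda>w. poly r (w j) * P w"])
        (simp_all add: polyfun.mult polyfun_poly polyfun.var)
  qed
  have nz: "\<exists>q\<in>I. poly q t \<noteq> 0" for t
  proof -
    obtain P where P: "P \<in> vanishing Z" "P (w(j := t)) \<noteq> 0"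
      using assms by blast
    then obtain q where "\<forall>t. P (w(j := t)) = poly q t"
      using polyfun_on_line[of P w j] by (auto simp: vanishing_def)
    then show ?thesis
      using P by (intro bexI[of _ q]) (auto simp: I_def)
  qed
  have "\<exists>g. g \<in> I \<and> g \<noteq> 0"
    using nz[of 0] by force
  from ex_has_least_nat[of "\<lambda>g. g \<in> I \<and> g \<noteq> 0" _ degree] this obtain g where
    g: "g \<in> I" "g \<noteq> 0" and least: "\<And>q. q \<in> I \<Longrightarrow> q \<noteq> 0 \<Longrightarrow> degree g \<le> degree q"
    by blast
  \<comment> \<open>An element of least degree divides all of \<open>I\<close>; were it not
    constant, its complex root would be a common zero of \<open>I\<close>, against
    \<open>nz\<close>.\<close>
  have "degree g = 0"
  proof (rule ccontr)
    assume deg: "degree g \<noteq> 0"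
    then have "\<not> constant (poly g)"
      by (simp add: constant_degree)
    then obtain t where t: "poly g t = 0"
      using fundamental_theorem_of_algebra by blast
    obtain q where q: "q \<in> I" "poly q t \<noteq> 0"
      using nz by blast
    have eq: "q mod g = q + (- (q div g)) * g"
      by (simp add: minus_div_mult_eq_mod)
    have "q mod g \<in> I"
      unfolding eq by (intro add mult q(1) g(1))
    then have "q mod g = 0"
      using least[of "q mod g"] degree_mod_less'[of g q] g(2) by force
    then have "g dvd q"
      by (simp add: mod_eq_0_iff_dvd)
    then show False
      using t q(2) by (auto elim!: dvdE)
  qed
  then obtain a where a: "g = [:a:]"
    by (rule degree_eq_zeroE)
  have "[:1 / a:] * g \<in> I"
    by (rule mult[OF g(1)])
  then have "1 \<in> I"
    using g(2) by (simp add: a one_pCons)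
  then show ?thesis
    by (simp add: I_def)
qed

subsection \<open>Elimination of projective variables\<close>

text \<open>The projection is encoded as a cylinder: the coordinates of \<open>w\<close> in
  \<open>J\<close> are arbitrary. All sets thus live over one index type and elimination can be
  iterated.\<close>

definition eliminate :: "'a set \<Rightarrow> ('a \<Rightarrow> complex) set \<Rightarrow> ('a \<Rightarrow> complex) set" where
  "eliminate J Z = {w. \<exists>u\<in>Z. (\<forall>i. i \<notin> J \<longrightarrow> u i = w i) \<and> (\<exists>j\<in>J. u j \<noteq> 0)}"

text \<open>The main theorem of elimination theory. In the induction step a single homogeneous coordinate
  \<open>j\<close> is projected out. The point with all other coordinates in \<open>J\<close> zero is not in the
  fibre over \<open>v\<close>, so some homogeneous equation \<open>h\<close> has a leading coefficient in the
  coordinate \<open>j\<close> that does not vanish at \<open>v\<close> and does not involve the variables in \<open>J\<close>;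
  resultants with \<open>h\<close> then cut out the projection near \<open>v\<close>.\<close>

theorem zclosed_eliminate:
  assumes "finite J" "zclosed Z" "conic J Z"
  shows "zclosed (eliminate J Z)"
  using assms
proof (induction J arbitrary: Z rule: finite_induct)
  case empty
  have "(\<lambda>_. 1) \<in> vanishing (eliminate {} Z)"
    by (simp add: vanishing_def eliminate_def polyfun.const)
  then show ?case
    unfolding zclosed_def by force
next
  case (insert j J)
  define K where "K = insert j J"
  have "\<exists>P\<in>vanishing (eliminate K Z). P v \<noteq> 0" if v: "v \<notin> eliminate K Z" for v
  proof -
    \<comment> \<open>The point over \<open>v\<close> with homogeneous coordinates 1 at
      \<open>j\<close> and 0 on \<open>J\<close>.\<close>
    define w1 where "w1 = (\<lambda>i. if i \<in> J then 0 else if i = j then 1 else v i)"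
    have "w1 \<notin> Z"
    proof
      assume "w1 \<in> Z"
      then have "v \<in> eliminate K Z"
        unfolding eliminate_def using insert.hyps(2)
        by (intro CollectI bexI[of _ w1]) (auto simp: w1_def K_def)
      with v show False ..
    qed
    then obtain P where "P \<in> vanishing Z" "P w1 \<noteq> 0"
      using insert.prems(1) unfolding zclosed_def by blast
    then obtain d h where h: "hpoly K d h" "h \<in> vanishing Z" "h w1 \<noteq> 0"
      using conic_vanishing_hpoly[OF insert.prems(2)[folded K_def]] by blast
    have K: "j \<in> K" "K - {j} = J"
      using insert.hyps(2) by (auto simp: K_def)
    from hpoly_expand[OF h(1) K(1)] obtain c where
      c: "\<forall>k\<le>d. hpoly J (d - k) (c k)" "\<forall>k>d. c k = (\<lambda>_. 0)"
        "\<forall>k w t. c k (w(j := t)) = c k w" "h = (\<lambda>w. \<Sum>k\<le>d. c k w * w j ^ k)"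
      unfolding K(2) by blast
    note c = c(1-3)[rule_format] c(4)
    \<comment> \<open>Every coefficient below the top one has positive degree in \<open>J\<close>,
      hence vanishes where the variables of \<open>J\<close> do.\<close>
    have top: "h w = c d w * w j ^ d" if w: "\<And>i. i \<in> J \<Longrightarrow> w i = 0" for w
    proof -
      have "rescale J 0 w = w"
        using w by (auto simp: rescale_def)
      then have "c k w = 0" if "k < d" for k
        using hpoly_rescale[OF c(1), of k 0 w] that by (simp add: power_0_left)
      then show ?thesis
        unfolding c(4) by (simp add: lessThan_Suc_atMost[symmetric])
    qed
    have c0: "hpoly J 0 (c d)"
      using c(1)[of d] by simp
    have cd_cong: "c d w = c d w'" if "\<And>i. i \<notin> K \<Longrightarrow> w i = w' i" for w w'
    proof -
      have "c d w = c d (w(j := w' j))"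
        by (rule c(3)[symmetric])
      also have "\<dots> = c d w'"
        using that by (intro hpoly_0_cong[OF c0]) (simp add: K_def)
      finally show ?thesis .
    qed
    have cv: "c d v \<noteq> 0"
    proof -
      have "c d w1 \<noteq> 0"
        using top[of w1] h(3) by (auto simp: w1_def)
      also have "c d w1 = c d v"
        by (rule cd_cong) (auto simp: w1_def K_def)
      finally show ?thesis .
    qed
    have pc: "polyfun (c k)" for k
      using c(1,2)[of k] by (cases "k \<le> d") (auto intro: hpoly_polyfun polyfun.const)

    \<comment> \<open>The affine projection along \<open>j\<close>, again a cylinder. It need not be
      closed, so the induction hypothesis is applied to its closure.\<close>
    define pr where "pr = {w. \<exists>t. w(j := t) \<in> Z}"
    have "conic J pr"
      unfolding conic_def
    proof (intro ballI allI)
      fix w s assume "w \<in> pr"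
      then obtain t where "w(j := t) \<in> Z"
        by (auto simp: pr_def)
      then have "rescale K s (w(j := t)) \<in> Z"
        using insert.prems(2) by (simp add: conic_def K_def)
      also have "rescale K s (w(j := t)) = (rescale J s w)(j := s * t)"
        by (auto simp: rescale_def K_def)
      finally show "rescale J s w \<in> pr"
        unfolding pr_def by blast
    qed
    then have closed: "zclosed (eliminate J (zclosure pr))"
      by (intro insert.IH zclosed_zclosure conic_zclosure)
    \<comment> \<open>Otherwise some \<open>u\<close> in the closure lies over \<open>v\<close>, and
      the line through \<open>u\<close> in direction \<open>j\<close> misses \<open>Z\<close>, so
      some \<open>p\<close> vanishing on \<open>Z\<close> equals 1 on that line. The resultant of
      \<open>h\<close> and \<open>p\<close> vanishes on \<open>pr\<close>, hence at
      \<open>u\<close>, but there it is a power of \<open>c d v\<close>, which is nonzero.\<close>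
    have "v \<notin> eliminate J (zclosure pr)"
    proof
      assume "v \<in> eliminate J (zclosure pr)"
      then obtain u i where u: "u \<in> zclosure pr" "\<And>i. i \<notin> J \<Longrightarrow> u i = v i" "i \<in> J" "u i \<noteq> 0"
        by (auto simp: eliminate_def)
      have "u(j := t) \<notin> Z" for t
      proof
        assume "u(j := t) \<in> Z"
        moreover have "\<forall>i. i \<notin> K \<longrightarrow> (u(j := t)) i = v i"
          using u(2) by (auto simp: K_def)
        moreover have "i \<in> K" "(u(j := t)) i \<noteq> 0"
          using insert.hyps(2) u(3,4) by (auto simp: K_def)
        ultimately have "v \<in> eliminate K Z"
          unfolding eliminate_def by blast
        with v show False ..
      qed
      then have "\<exists>P\<in>vanishing Z. P (u(j := t)) \<noteq> 0" for t
        using insert.prems(1) by (simp add: zclosed_def)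
      from vanishing_eq_1_on_line[OF this] obtain p where
        p: "p \<in> vanishing Z" "\<And>t. p (u(j := t)) = 1"
        by blast
      then have "polyfun p"
        by (simp add: vanishing_def)
      from polyfun_expand[OF this, of j] obtain N b where
        b: "\<forall>k. polyfun (b k)" "\<forall>k w t. b k (w(j := t)) = b k w"
          "p = (\<lambda>w. \<Sum>k\<le>N. b k w * w j ^ k)"
        by blast
      \<comment> \<open>Padding by a zero coefficient makes the formal degree \<open>Suc N\<close>
        positive, as \<open>polyfun_resultant\<close> requires.\<close>
      define b' where "b' = (\<lambda>k. if k \<le> N then b k else (\<lambda>_. 0))"
      have b'_sum: "(\<Sum>k\<le>Suc N. b' k w * t ^ k) = p (w(j := t))" for w t
        by (simp add: b(3) b(2)[rule_format] b'_def del: fun_upd_apply) (simp add: b)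
      have "polyfun (b' k)" for k
        using b(1) by (simp add: b'_def polyfun.const)
      from polyfun_resultant[of c b' "Suc N" d, OF pc this] obtain R where
        R: "polyfun R"
          "\<And>w t. (\<Sum>k\<le>d. c k w * t ^ k) = 0 \<Longrightarrow> (\<Sum>k\<le>Suc N. b' k w * t ^ k) = 0 \<Longrightarrow> R w = 0"
          "\<And>w. b' 0 w = 1 \<Longrightarrow> \<forall>k\<in>{1..Suc N}. b' k w = 0 \<Longrightarrow> R w = c d w ^ Suc N"
        by blast
      have "R w = 0" if w: "w \<in> pr" for w
      proof -
        from w obtain t where t: "w(j := t) \<in> Z"
          by (auto simp: pr_def)
        have "h (w(j := t)) = 0" "p (w(j := t)) = 0"
          using h(2) p(1) t by (simp_all add: vanishing_def)
        moreover have "h (w(j := t)) = (\<Sum>k\<le>d. c k w * t ^ k)"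
          by (simp add: c(4) c(3) del: fun_upd_apply) (simp add: c(3))
        ultimately show ?thesis
          using R(2)[of w t] b'_sum[of w t] by simp
      qed
      then have "R u = 0"
        using u(1) R(1) by (simp add: zclosure_def vanishing_def)
      moreover have "b' 0 u = 1 \<and> (\<forall>k\<in>{1..Suc N}. b' k u = 0)"
        using polyfun_eq_const[of "\<lambda>k. b' k u" "Suc N" 1] b'_sum[of u] p(2) by simp
      then have "R u = c d u ^ Suc N"
        using R(3) by blast
      moreover have "c d u = c d v"
        using u(2) by (intro cd_cong) (auto simp: K_def)
      ultimately show False
        using cv by simp
    qed
    then obtain P where P: "polyfun P" "\<And>u. u \<in> eliminate J (zclosure pr) \<Longrightarrow> P u = 0" "P v \<noteq> 0"
      using closed unfolding zclosed_def vanishing_def by blast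
    \<comment> \<open>The factor \<open>P\<close> handles points with a nonzero coordinate in
      \<open>J\<close>. At the others only the coordinate \<open>j\<close> is nonzero, and
      \<open>h = 0\<close> forces \<open>c d\<close> to vanish.\<close>
    have "c d w * P w = 0" if w: "w \<in> eliminate K Z" for w
    proof -
      from w obtain u i where u: "u \<in> Z" "\<And>i. i \<notin> K \<Longrightarrow> u i = w i" "i \<in> K" "u i \<noteq> 0"
        by (auto simp: eliminate_def)
      show ?thesis
      proof (cases "\<exists>i\<in>J. u i \<noteq> 0")
        case True
        \<comment> \<open>The cylinder shape of \<open>pr\<close> lets the coordinate
          \<open>j\<close> be reset to agree with \<open>w\<close>.\<close>
        have "u(j := w j) \<in> pr"
          unfolding pr_def using u(1) by (intro CollectI exI[of _ "u j"]) simp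
        then have "u(j := w j) \<in> zclosure pr"
          using zclosure_superset by blast
        moreover have "\<forall>i. i \<notin> J \<longrightarrow> (u(j := w j)) i = w i"
          using u(2) by (auto simp: K_def)
        moreover have "\<exists>i\<in>J. (u(j := w j)) i \<noteq> 0"
          using True insert.hyps(2) by force
        ultimately have "w \<in> eliminate J (zclosure pr)"
          unfolding eliminate_def by blast
        then show ?thesis
          using P(2) by simp
      next
        case False
        then have "c d u * u j ^ d = 0"
          using top[of u] u(1) h(2) by (simp add: vanishing_def)
        moreover have "u j \<noteq> 0"
          using False u(3,4) by (auto simp: K_def)
        ultimately show ?thesis
          using cd_cong[of u w] u(2) by simp
      qed
    qed
    then show ?thesis
      using pc P cv
      by (intro bexI[of _ "\<lambda>w. c d w * P w"]) (simp_all add: vanishing_def polyfun.mult)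
  qed
  then show ?case
    unfolding zclosed_def K_def by blast
qed

text \<open>A product of projective spaces is eliminated one factor at a time. Disjointness keeps
  the intermediate set conic in the next group of variables.\<close>

lemma zclosed_eliminate_family:
  assumes "finite S" "zclosed Z" "disjoint_family_on J S"
    and "\<And>k. k \<in> S \<Longrightarrow> finite (J k)" "\<And>k. k \<in> S \<Longrightarrow> conic (J k) Z"
  shows "zclosed {w. \<exists>u\<in>Z. (\<forall>i. i \<notin> (\<Union>k\<in>S. J k) \<longrightarrow> u i = w i) \<and> (\<forall>k\<in>S. \<exists>j\<in>J k. u j \<noteq> 0)}"
    (is "zclosed (?E S)")
  using assms(1,3-5)
proof (induction S rule: finite_induct)
  case empty
  have "?E {} = Z"
    by (auto simp: fun_eq_iff[symmetric])
  then show ?case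
    using assms(2) by simp
next
  case (insert k S)
  have dis: "J k \<inter> J l = {}" if "l \<in> S" for l
    using insert.prems(1) insert.hyps(2) that by (auto simp: disjoint_family_on_def)
  have "zclosed (?E S)"
    using insert.prems by (intro insert.IH) (auto simp: disjoint_family_on_def)
  moreover have "conic (J k) (?E S)"
    unfolding conic_def
  proof (intro ballI allI)
    fix w t assume "w \<in> ?E S"
    then obtain u where u: "u \<in> Z" "\<forall>i. i \<notin> (\<Union>k\<in>S. J k) \<longrightarrow> u i = w i"
      "\<forall>k\<in>S. \<exists>j\<in>J k. u j \<noteq> 0"
      by blast
    have "rescale (J k) t u \<in> Z"
      using insert.prems(3)[of k] u(1) by (simp add: conic_def)
    moreover have "\<forall>l\<in>S. \<exists>j\<in>J l. rescale (J k) t u j \<noteq> 0"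
      using u(3) dis by (fastforce simp: rescale_def)
    ultimately show "rescale (J k) t w \<in> ?E S"
      using u(2) by (intro CollectI bexI[of _ "rescale (J k) t u"]) (auto simp: rescale_def)
  qed
  ultimately have "zclosed (eliminate (J k) (?E S))"
    using insert.prems(2) by (intro zclosed_eliminate) auto
  also have "eliminate (J k) (?E S) = ?E (insert k S)"
  proof (intro equalityI subsetI)
    fix w assume "w \<in> eliminate (J k) (?E S)"
    then obtain u u' where u: "u' \<in> Z" "\<And>i. i \<notin> J k \<Longrightarrow> u i = w i" "\<exists>j\<in>J k. u j \<noteq> 0"
      "\<And>i. i \<notin> (\<Union>k\<in>S. J k) \<Longrightarrow> u' i = u i" "\<And>k. k \<in> S \<Longrightarrow> \<exists>j\<in>J k. u' j \<noteq> 0"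
      unfolding eliminate_def by blast
    have "u' j = u j" if "j \<in> J k" for j
      using that dis by (intro u(4)) auto
    then have "\<exists>j\<in>J k. u' j \<noteq> 0"
      using u(3) by auto
    then show "w \<in> ?E (insert k S)"
      using u by (intro CollectI bexI[of _ u']) auto
  next
    fix w assume "w \<in> ?E (insert k S)"
    then obtain u where u: "u \<in> Z" "\<And>i. i \<notin> J k \<Longrightarrow> i \<notin> (\<Union>k\<in>S. J k) \<Longrightarrow> u i = w i"
      "\<exists>j\<in>J k. u j \<noteq> 0" "\<And>l. l \<in> S \<Longrightarrow> \<exists>j\<in>J l. u j \<noteq> 0"
      by auto
    \<comment> \<open>The intermediate point: group \<open>k\<close> is already lifted to
      \<open>u\<close>, everything else still agrees with \<open>w\<close>.\<close>
    define u' where "u' = (\<lambda>i. if i \<in> J k then u i else w i)"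
    have "u' \<in> ?E S"
      using u by (intro CollectI bexI[of _ u]) (auto simp: u'_def)
    moreover have "\<forall>i. i \<notin> J k \<longrightarrow> u' i = w i" "\<exists>j\<in>J k. u' j \<noteq> 0"
      using u(3) by (auto simp: u'_def)
    ultimately show "w \<in> eliminate (J k) (?E S)"
      unfolding eliminate_def by blast
  qed
  finally show ?case .
qed

subsection \<open>Evaluation of polynomials\<close>

lemma poly_mapping_eq_sum_single: "p = (\<Sum>m\<in>Poly_Mapping.keys p. Poly_Mapping.single m (Poly_Mapping.lookup p m))"
proof (rule poly_mapping_eqI)
  fix k
  have "(\<Sum>m\<in>Poly_Mapping.keys p. Poly_Mapping.lookup (Poly_Mapping.single m (Poly_Mapping.lookup p m)) k) =
      (\<Sum>m\<in>Poly_Mapping.keys p. if m = k then Poly_Mapping.lookup p k else 0)"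
    by (intro sum.cong) (auto simp: lookup_single)
  then show "Poly_Mapping.lookup p k = Poly_Mapping.lookup (\<Sum>m\<in>Poly_Mapping.keys p.
      Poly_Mapping.single m (Poly_Mapping.lookup p m)) k"
    by (simp add: lookup_sum in_keys_iff)
qed

lemma prod_single:
  "(\<Prod>i\<in>A. Poly_Mapping.single (f i) (c i :: 'a::comm_semiring_1)) =
    Poly_Mapping.single (\<Sum>i\<in>A. f i :: 'b::comm_monoid_add) (\<Prod>i\<in>A. c i)"
  by (induction A rule: infinite_finite_induct) (simp_all add: mult_single)

definition eval_monom :: "('v \<Rightarrow> 'b::comm_semiring_1) \<Rightarrow> ('v \<Rightarrow>\<^sub>0 nat) \<Rightarrow> 'b" where
  "eval_monom x m = (\<Prod>i\<in>Poly_Mapping.keys m. x i ^ Poly_Mapping.lookup m i)"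

lemma eval_monom_superset:
  assumes "finite S" "Poly_Mapping.keys m \<subseteq> S"
  shows "eval_monom x m = (\<Prod>i\<in>S. x i ^ Poly_Mapping.lookup m i)"
  unfolding eval_monom_def using assms
  by (intro prod.mono_neutral_left) (auto simp: in_keys_iff)

lemma eval_monom_add: "eval_monom x (m + n) = eval_monom x m * eval_monom x n"
proof -
  let ?S = "Poly_Mapping.keys m \<union> Poly_Mapping.keys n"
  have "finite ?S" "Poly_Mapping.keys m \<subseteq> ?S" "Poly_Mapping.keys n \<subseteq> ?S" "Poly_Mapping.keys (m + n) \<subseteq> ?S"
    using keys_add[of m n] by auto
  then show ?thesis
    by (simp add: eval_monom_superset[of ?S] lookup_add power_add prod.distrib)
qed

lemma eval_monom_0 [simp]: "eval_monom x 0 = 1"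
  by (simp add: eval_monom_def)

lemma eval_monom_single [simp]: "eval_monom x (Poly_Mapping.single i k) = x i ^ k"
  by (simp add: eval_monom_def)

text \<open>Covers both uses of \<open>eval_mpoly\<close>: evaluation at numbers (\<open>id\<close>)
  and substitution of polynomials (\<open>Const\<close>).\<close>

locale coeff_hom =
  fixes \<phi> :: "'a::comm_semiring_1 \<Rightarrow> 'b::comm_semiring_1"
  assumes zero [simp]: "\<phi> 0 = 0"
    and one [simp]: "\<phi> 1 = 1"
    and add: "\<phi> (a + b) = \<phi> a + \<phi> b"
    and mult: "\<phi> (a * b) = \<phi> a * \<phi> b"
begin

lemma eval_superset:
  assumes "finite S" "Poly_Mapping.keys p \<subseteq> S"
  shows "eval_mpoly \<phi> x p = (\<Sum>m\<in>S. \<phi> (Poly_Mapping.lookup p m) * eval_monom x m)"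
  unfolding eval_mpoly_def eval_monom_def[symmetric] using assms
  by (intro sum.mono_neutral_left) (auto simp: in_keys_iff)

lemma eval_0 [simp]: "eval_mpoly \<phi> x 0 = 0"
  by (simp add: eval_mpoly_def)

lemma eval_add: "eval_mpoly \<phi> x (p + q) = eval_mpoly \<phi> x p + eval_mpoly \<phi> x q"
proof -
  let ?S = "Poly_Mapping.keys p \<union> Poly_Mapping.keys q"
  have "finite ?S" "Poly_Mapping.keys p \<subseteq> ?S" "Poly_Mapping.keys q \<subseteq> ?S" "Poly_Mapping.keys (p + q) \<subseteq> ?S"
    using keys_add[of p q] by auto
  then show ?thesis
    by (simp add: eval_superset[of ?S] lookup_add add distrib_right sum.distrib)
qed

lemma eval_sum: "eval_mpoly \<phi> x (\<Sum>i\<in>A. f i) = (\<Sum>i\<in>A. eval_mpoly \<phi> x (f i))"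
  by (induction A rule: infinite_finite_induct) (simp_all add: eval_add)

lemma eval_single: "eval_mpoly \<phi> x (Poly_Mapping.single m c) = \<phi> c * eval_monom x m"
  by (subst eval_superset[of "{m}"]) simp_all

lemma eval_mult: "eval_mpoly \<phi> x (p * q) = eval_mpoly \<phi> x p * eval_mpoly \<phi> x q"
proof -
  let ?s = "\<lambda>p m. Poly_Mapping.single m (Poly_Mapping.lookup p m)"
  have "eval_mpoly \<phi> x ((\<Sum>m\<in>Poly_Mapping.keys p. ?s p m) * (\<Sum>n\<in>Poly_Mapping.keys q. ?s q n)) =
      eval_mpoly \<phi> x (\<Sum>m\<in>Poly_Mapping.keys p. ?s p m) * eval_mpoly \<phi> x (\<Sum>n\<in>Poly_Mapping.keys q. ?s q n)"
    by (simp add: sum_product eval_sum mult_single eval_single eval_monom_add mult mult_ac)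
  then show ?thesis
    by (simp flip: poly_mapping_eq_sum_single)
qed

lemma eval_Const [simp]: "eval_mpoly \<phi> x (Const c) = \<phi> c"
  by (simp add: Const_def eval_single)

lemma eval_1 [simp]: "eval_mpoly \<phi> x 1 = 1"
  using eval_single[of x 0 1] by simp

lemma eval_Var [simp]: "eval_mpoly \<phi> x (Var i) = x i"
  by (simp add: Var_def eval_single)

lemma eval_power: "eval_mpoly \<phi> x (p ^ n) = eval_mpoly \<phi> x p ^ n"
  by (induction n) (simp_all add: eval_mult)

lemma eval_prod: "eval_mpoly \<phi> x (\<Prod>i\<in>A. f i) = (\<Prod>i\<in>A. eval_mpoly \<phi> x (f i))"
  by (induction A rule: infinite_finite_induct) (simp_all add: eval_mult)

end

interpretation id_hom: coeff_hom id
  by unfold_locales simp_all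

interpretation Const_hom: coeff_hom Const
  by unfold_locales (simp_all add: Const_def single_add mult_single)

text \<open>Links \<open>polyfun\<close> to the polynomials by which
  \<open>zariski_closed_in_quintics\<close> is defined.\<close>

lemma polyfun_imp_mpoly:
  assumes "polyfun h"
  shows "\<exists>Q. \<forall>v. eval_mpoly id v Q = h v"
  using assms
proof induction
  case (const c)
  show ?case
    by (rule exI, rule allI, rule trans[OF id_hom.eval_Const id_apply])
next
  case (var i)
  show ?case
    by (rule exI, rule allI, rule id_hom.eval_Var)
next
  case (add f g)
  then show ?case
    by (metis id_hom.eval_add)
next
  case (mult f g)
  then show ?case
    by (metis id_hom.eval_mult)
qed

section \<open>Substitution and the action of matrices\<close>

lemma eval_Const_comp:
  "eval_mpoly Const y (eval_mpoly Const x f) = eval_mpoly Const (\<lambda>i. eval_mpoly Const y (x i)) f"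
proof -
  have "eval_mpoly Const y (eval_mpoly Const x f) = (\<Sum>m\<in>Poly_Mapping.keys f. eval_mpoly Const y
      (Const (Poly_Mapping.lookup f m) * (\<Prod>i\<in>Poly_Mapping.keys m. x i ^ Poly_Mapping.lookup m i)))"
    by (subst eval_mpoly_def[of Const x f]) (rule Const_hom.eval_sum)
  then show ?thesis
    by (simp add: Const_hom.eval_mult Const_hom.eval_prod Const_hom.eval_power eval_mpoly_def[of Const _ f])
qed

lemma single_Var_power: "Var i ^ k = Poly_Mapping.single (Poly_Mapping.single i k) 1"
proof (induction k)
  case (Suc k)
  then show ?case
    by (simp add: Var_def mult_single single_add[symmetric])
qed simp

lemma eval_Const_Var:
  fixes f :: "('v, 'a::comm_semiring_1) mpoly"
  shows "eval_mpoly Const Var f = f"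
proof -
  have "(\<Prod>i\<in>Poly_Mapping.keys m. Var i ^ Poly_Mapping.lookup m i) = Poly_Mapping.single m (1::'a)"
    for m :: "'v \<Rightarrow>\<^sub>0 nat"
    by (simp add: single_Var_power prod_single flip: poly_mapping_eq_sum_single)
  then have "eval_mpoly Const Var f = (\<Sum>m\<in>Poly_Mapping.keys f. Poly_Mapping.single m (Poly_Mapping.lookup f m))"
    by (simp add: eval_mpoly_def Const_def mult_single)
  then show ?thesis
    by (simp flip: poly_mapping_eq_sum_single)
qed

lemma act_act: "act B (act A f) = act (B ** A) f"
proof -
  have "eval_mpoly Const (\<lambda>j. \<Sum>i\<in>UNIV. Const (B $ i $ j) * Var i) (\<Sum>i\<in>UNIV. Const (A $ i $ j) * Var i) =
      (\<Sum>i\<in>UNIV. Const ((B ** A) $ i $ j) * Var i)" for j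
  proof -
    have "(\<Sum>i\<in>UNIV. Const (A $ i $ j) * (\<Sum>k\<in>UNIV. Const (B $ k $ i) * Var k)) =
        (\<Sum>k\<in>UNIV. \<Sum>i\<in>UNIV. Const (A $ i $ j) * (Const (B $ k $ i) * Var k))"
      unfolding sum_distrib_left by (rule sum.swap)
    moreover have "(Const (\<Sum>i\<in>A. c i) :: form5) = (\<Sum>i\<in>A. Const (c i))" for A and c :: "5 \<Rightarrow> complex"
      by (induction A rule: infinite_finite_induct) (simp_all add: Const_hom.add)
    ultimately show ?thesis
      by (simp add: Const_hom.eval_sum Const_hom.eval_mult matrix_matrix_mult_def Const_hom.mult
        sum_distrib_left sum_distrib_right mult_ac)
  qed
  then show ?thesis
    by (simp add: act_def eval_Const_comp)
qed

lemma act_mat_1: "act (mat 1) f = f"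
proof -
  have "(\<Sum>i\<in>UNIV. Const ((mat 1 :: complex^5^5) $ i $ j) * Var i) = Var j" for j
  proof -
    have "(\<Sum>i\<in>UNIV. Const ((mat 1 :: complex^5^5) $ i $ j) * Var i) =
        (\<Sum>i\<in>UNIV. if i = j then Var j else 0)"
      by (intro sum.cong) (auto simp: Finite_Cartesian_Product.mat_def)
    then show ?thesis
      by simp
  qed
  then show ?thesis
    by (simp add: act_def eval_Const_Var)
qed

subsection \<open>Products of linear forms\<close>

definition column_form :: "complex^'n^'n \<Rightarrow> 'n \<Rightarrow> ('n, complex) mpoly" where
  "column_form C j = (\<Sum>i\<in>UNIV. Const (C $ i $ j) * Var i)"

definition form_product :: "complex^'n^'n \<Rightarrow> ('n, complex) mpoly" where
  "form_product C = (\<Prod>j\<in>UNIV. column_form C j)"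

lemma UNIV_5: "(UNIV :: 5 set) = {0, 1, 2, 3, 4}"
proof -
  have "x = 0 \<or> x = 1 \<or> x = 2 \<or> x = 3 \<or> x = 4" for x :: 5
  proof (induct x)
    case (of_int z)
    then have "0 \<le> z" and "z < 5"
      by simp_all
    then have "z = 0 \<or> z = 1 \<or> z = 2 \<or> z = 3 \<or> z = 4"
      by arith
    then show ?case
      by auto
  qed
  then show ?thesis
    by auto
qed

lemma act_monomial: "act C (Var 0 * Var 1 * Var 2 * Var 3 * Var 4) = form_product C"
proof -
  have "(\<Prod>j\<in>UNIV. g j) = g 0 * g 1 * g 2 * g 3 * g 4" for g :: "5 \<Rightarrow> (5, complex) mpoly"
    unfolding UNIV_5 by (simp add: mult.assoc)
  then show ?thesis
    by (simp only: act_def Const_hom.eval_mult Const_hom.eval_Var form_product_def column_form_def)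
qed

text \<open>Expand the product: the function \<open>c\<close> chooses the variable taken from each
  factor.\<close>

lemma lookup_form_product:
  fixes C :: "complex^'n^'n"
  shows "Poly_Mapping.lookup (form_product C) m =
    (\<Sum>c\<in>UNIV. if (\<Sum>j\<in>UNIV. Poly_Mapping.single (c j) 1) = m then \<Prod>j\<in>UNIV. C $ c j $ j else 0)"
proof -
  have "form_product C = (\<Sum>c\<in>UNIV. \<Prod>j\<in>UNIV. Poly_Mapping.single (Poly_Mapping.single (c j) 1) (C $ c j $ j))"
    unfolding form_product_def column_form_def Const_def Var_def
    by (subst prod_sum_PiE) (simp_all add: mult_single)
  then show ?thesis
    by (simp add: prod_single lookup_sum lookup_single when_def)
qed

lemma form_product_homogeneous:
  fixes C :: "complex^'n^'n"
  assumes "m \<in> Poly_Mapping.keys (form_product C)"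
  shows "(\<Sum>i\<in>UNIV. Poly_Mapping.lookup m i) = CARD('n)"
proof -
  obtain c :: "'n \<Rightarrow> 'n" where m: "m = (\<Sum>j\<in>UNIV. Poly_Mapping.single (c j) 1)"
  proof (rule ccontr)
    assume "\<not> thesis"
    then have "Poly_Mapping.lookup (form_product C) m = 0"
      unfolding lookup_form_product using that by (intro sum.neutral) auto
    then show False
      using assms by (simp add: in_keys_iff)
  qed
  have "(\<Sum>i\<in>UNIV. Poly_Mapping.lookup m i) = (\<Sum>j\<in>UNIV. \<Sum>i\<in>UNIV. if i = c j then 1 else 0)"
    unfolding m lookup_sum by (subst sum.swap) (auto simp: lookup_single when_def intro!: sum.cong)
  then show ?thesis
    by simp
qed

text \<open>No factor is zero and the polynomial ring has no zero divisors; the linear order on the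
  variables serves to order the monomials for this.\<close>

lemma form_product_neq_0:
  fixes C :: "complex ^ ('n::{finite,linorder}) ^ ('n::{finite,linorder})"
  assumes "\<And>j. \<exists>i. C $ i $ j \<noteq> 0"
  shows "form_product C \<noteq> 0"
proof -
  have "column_form C j \<noteq> 0" for j
  proof -
    obtain i where i: "C $ i $ j \<noteq> 0"
      using assms by blast
    have [simp]: "Poly_Mapping.single k (1::nat) = Poly_Mapping.single i 1 \<longleftrightarrow> k = i" for k
      by (metis lookup_single_eq lookup_single_not_eq zero_neq_one)
    have "Poly_Mapping.lookup (column_form C j) (Poly_Mapping.single i 1) =
        (\<Sum>k\<in>UNIV. if k = i then C $ i $ j else 0)"
      unfolding column_form_def Const_def Var_def lookup_sum mult_single
      by (intro sum.cong) (auto simp: lookup_single when_def simp del: One_nat_def)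
    then show ?thesis
      using i by auto
  qed
  then show ?thesis
    by (simp add: form_product_def)
qed

definition scale_column :: "'n \<Rightarrow> 'a::comm_ring_1 \<Rightarrow> 'a^'n^'n \<Rightarrow> 'a^'n^'n" where
  "scale_column k t C = (\<chi> i j. if j = k then t * C $ i $ j else C $ i $ j)"

lemma det_scale_column: "det (scale_column k t C) = t * det C"
proof -
  have "transpose (scale_column k t C) =
      (\<chi> j. if j = k then t *s (transpose C $ j) else transpose C $ j)"
    by (simp add: Finite_Cartesian_Product.vec_eq_iff transpose_def scale_column_def)
  moreover have "(\<chi> j. if j = k then transpose C $ j else transpose C $ j) = transpose C"
    by (simp add: Finite_Cartesian_Product.vec_eq_iff)
  ultimately have "det (transpose (scale_column k t C)) = t * det (transpose C)"
    using det_row_mul[of k t "\<lambda>j. transpose C $ j" "\<lambda>j. transpose C $ j"] by simp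
  then show ?thesis
    by (simp only: Determinants.det_transpose)
qed

text \<open>Each term of the expansion contains exactly one entry of column
  \<open>k\<close>.\<close>

lemma lookup_form_product_scale_column:
  "Poly_Mapping.lookup (form_product (scale_column k t C)) m = t * Poly_Mapping.lookup (form_product C) m"
proof -
  have "(\<Prod>j\<in>UNIV. scale_column k t C $ c j $ j) = t * (\<Prod>j\<in>UNIV. C $ c j $ j)" for c
  proof -
    have "(\<Prod>j\<in>UNIV. scale_column k t C $ c j $ j) =
        (\<Prod>j\<in>UNIV. (if j = k then t else 1) * C $ c j $ j)"
      by (intro prod.cong) (auto simp: scale_column_def)
    then show ?thesis
      by (simp add: prod.distrib)
  qed
  then show ?thesis
    by (simp add: lookup_form_product sum_distrib_left if_distrib cong: if_cong)
qed

section \<open>The incidence variety of forms and their linear factors\<close>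

text \<open>Points of the product space are functions on a sum type: \<open>Inl\<close> indexes the
  coefficients of a form, \<open>Inr\<close> the entries of a matrix.\<close>

definition matrix_of :: "('m + 'n \<times> 'n \<Rightarrow> complex) \<Rightarrow> complex^'n^'n" where
  "matrix_of w = (\<chi> i j. w (Inr (i, j)))"

lemma polyfun_det_matrix_of: "polyfun (\<lambda>w. det (matrix_of w))"
  unfolding Determinants.det_def matrix_of_def
  by (simp add: polyfun_sum polyfun_prod polyfun.const polyfun.var polyfun.mult)

lemma polyfun_form_product_matrix_of:
  "polyfun (\<lambda>w. Poly_Mapping.lookup (form_product (matrix_of w)) m)"
  unfolding lookup_form_product matrix_of_def
  by (simp add: polyfun_sum polyfun_prod polyfun.const polyfun.var polyfun_if)

definition det_incidence :: "complex \<Rightarrow> (('n::finite \<Rightarrow>\<^sub>0 nat) + 'n \<times> 'n \<Rightarrow> complex) set" where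
  "det_incidence \<delta> = {w. \<forall>m. det (matrix_of w) * w (Inl m) =
     \<delta> * Poly_Mapping.lookup (form_product (matrix_of w)) m}"

lemma zclosed_det_incidence: "zclosed (det_incidence \<delta>)"
  unfolding zclosed_def
proof (intro allI impI)
  fix v assume "v \<notin> det_incidence \<delta>"
  then obtain m where m: "det (matrix_of v) * v (Inl m) \<noteq>
      \<delta> * Poly_Mapping.lookup (form_product (matrix_of v)) m"
    by (auto simp: det_incidence_def)
  let ?P = "\<lambda>w. det (matrix_of w) * w (Inl m) +
      (- \<delta>) * Poly_Mapping.lookup (form_product (matrix_of w)) m"
  have "polyfun ?P"
    by (intro polyfun.add polyfun.mult polyfun.const polyfun.var polyfun_det_matrix_of
      polyfun_form_product_matrix_of)
  then show "\<exists>P\<in>vanishing (det_incidence \<delta>). P v \<noteq> 0"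
    using m by (intro bexI[of _ ?P]) (auto simp: vanishing_def det_incidence_def)
qed

text \<open>Both sides of the defining equations are linear in each column.\<close>

lemma conic_det_incidence:
  fixes j :: "'n::finite"
  shows "conic (range (\<lambda>i. Inr (i, j))) (det_incidence \<delta>)"
  unfolding conic_def
proof (intro ballI allI)
  fix w :: "('n \<Rightarrow>\<^sub>0 nat) + 'n \<times> 'n \<Rightarrow> complex" and t
  assume w: "w \<in> det_incidence \<delta>"
  let ?w = "rescale (range (\<lambda>i. Inr (i, j))) t w"
  have "matrix_of ?w = scale_column j t (matrix_of w)"
    by (auto simp: matrix_of_def scale_column_def rescale_def Finite_Cartesian_Product.vec_eq_iff)
  moreover have "?w (Inl m) = w (Inl m)" for m
    by (auto simp: rescale_def)
  ultimately show "?w \<in> det_incidence \<delta>"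
    using w by (simp add: det_incidence_def det_scale_column lookup_form_product_scale_column mult.assoc
      mult.left_commute[of \<delta>])
qed

text \<open>A nonzero determinant excludes zero columns. Conversely, nonzero columns give a nonzero
  product, so the equations force \<open>det C\<close> to be nonzero, and rescaling one column
  corrects it to \<delta>.\<close>

lemma form_product_orbit_iff:
  fixes F :: "('n::{finite,linorder}, complex) mpoly"
  assumes "\<delta> \<noteq> 0"
  shows "(\<exists>C. det C = \<delta> \<and> F = form_product C) \<longleftrightarrow>
    (\<exists>u\<in>det_incidence \<delta>. (\<forall>m. u (Inl m) = Poly_Mapping.lookup F m) \<and> (\<forall>j. \<exists>i. u (Inr (i, j)) \<noteq> 0))"
proof
  assume "\<exists>C. det C = \<delta> \<and> F = form_product C"
  then obtain C where C: "det C = \<delta>" "F = form_product C"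
    by blast
  define u where "u = case_sum (Poly_Mapping.lookup F) (\<lambda>(i, j). C $ i $ j)"
  have u: "matrix_of u = C"
    by (simp add: matrix_of_def u_def Finite_Cartesian_Product.vec_eq_iff)
  have Inl: "u (Inl m) = Poly_Mapping.lookup F m" for m
    by (simp add: u_def)
  have "u \<in> det_incidence \<delta>"
    by (simp add: det_incidence_def u Inl C)
  moreover have "\<exists>i. u (Inr (i, j)) \<noteq> 0" for j
  proof (rule ccontr)
    assume "\<nexists>i. u (Inr (i, j)) \<noteq> 0"
    then have "column j C = 0"
      by (simp add: u_def column_def Finite_Cartesian_Product.vec_eq_iff)
    then show False
      using det_zero_column[of j C] C(1) assms by simp
  qed
  ultimately show "\<exists>u\<in>det_incidence \<delta>. (\<forall>m. u (Inl m) = Poly_Mapping.lookup F m) \<and>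
      (\<forall>j. \<exists>i. u (Inr (i, j)) \<noteq> 0)"
    using Inl by blast
next
  assume "\<exists>u\<in>det_incidence \<delta>. (\<forall>m. u (Inl m) = Poly_Mapping.lookup F m) \<and>
    (\<forall>j. \<exists>i. u (Inr (i, j)) \<noteq> 0)"
  then obtain u where u: "u \<in> det_incidence \<delta>" "\<And>m. u (Inl m) = Poly_Mapping.lookup F m"
    "\<And>j. \<exists>i. u (Inr (i, j)) \<noteq> 0"
    by blast
  define C where "C = matrix_of u"
  have eq: "det C * Poly_Mapping.lookup F m = \<delta> * Poly_Mapping.lookup (form_product C) m" for m
    using u(1,2) by (simp add: det_incidence_def C_def)
  have "form_product C \<noteq> 0"
    using u(3) by (intro form_product_neq_0) (simp add: C_def matrix_of_def)
  then obtain m where "Poly_Mapping.lookup (form_product C) m \<noteq> 0"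
    by (metis lookup_zero poly_mapping_eqI)
  then have det: "det C \<noteq> 0"
    using eq[of m] assms by auto
  \<comment> \<open>Any index will do as the column to be rescaled.\<close>
  obtain k :: 'n where True
    by simp
  let ?C = "scale_column k (\<delta> / det C) C"
  have "det ?C = \<delta>"
    using det by (simp add: det_scale_column)
  moreover have "F = form_product ?C"
    by (rule poly_mapping_eqI) (use eq det in \<open>simp add: lookup_form_product_scale_column field_simps\<close>)
  ultimately show "\<exists>C. det C = \<delta> \<and> F = form_product C"
    by blast
qed

section \<open>Closedness of the orbit\<close>

lemma zariski_closed_form_products:
  assumes "\<delta> \<noteq> 0"
  shows "zariski_closed_in_quintics {form_product C | C. det C = \<delta>}" (is "zariski_closed_in_quintics ?O")
proof -
  let ?J = "\<lambda>j. range (\<lambda>i. Inr (i, j)) :: ((5 \<Rightarrow>\<^sub>0 nat) + 5 \<times> 5) set"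
  define E where "E = {w. \<exists>u\<in>det_incidence \<delta>. (\<forall>i. i \<notin> (\<Union>j\<in>UNIV. ?J j) \<longrightarrow> u i = w i) \<and>
    (\<forall>j\<in>UNIV. \<exists>i\<in>?J j. u i \<noteq> 0)}"
  \<comment> \<open>Embeds coefficient vectors into the product space. The zeros are arbitrary, as
    \<open>E\<close> is a cylinder over the coefficients.\<close>
  let ?w = "\<lambda>v :: (5 \<Rightarrow>\<^sub>0 nat) \<Rightarrow> complex. case_sum v (\<lambda>_ :: 5 \<times> 5. 0 :: complex)"
  have closed: "zclosed E"
    unfolding E_def by (intro zclosed_eliminate_family zclosed_det_incidence conic_det_incidence)
      (auto simp: disjoint_family_on_def)
  have "(\<forall>i. i \<notin> (\<Union>j\<in>UNIV. ?J j) \<longrightarrow> u i = w i) \<longleftrightarrow> (\<forall>m. u (Inl m) = w (Inl m))"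
    for u w :: "(5 \<Rightarrow>\<^sub>0 nat) + 5 \<times> 5 \<Rightarrow> complex"
    by (auto simp: image_iff split: sum.split) (metis sum.exhaust surj_pair)
  then have E: "?w (Poly_Mapping.lookup F) \<in> E \<longleftrightarrow> F \<in> ?O" for F
    unfolding E_def
    using form_product_orbit_iff[OF assms, of F] by (simp del: UN_iff) blast
  define S where "S = {Q. \<forall>F\<in>?O. eval_mpoly id (Poly_Mapping.lookup F) Q = 0}"
  have "?O = {F \<in> quintic_forms. \<forall>Q\<in>S. eval_mpoly id (Poly_Mapping.lookup F) Q = 0}"
  proof (intro equalityI subsetI)
    fix F assume "F \<in> ?O"
    then show "F \<in> {F \<in> quintic_forms. \<forall>Q\<in>S. eval_mpoly id (Poly_Mapping.lookup F) Q = 0}"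
      using form_product_homogeneous[where 'n = 5] by (auto simp: S_def quintic_forms_def)
  next
    fix F assume F: "F \<in> {F \<in> quintic_forms. \<forall>Q\<in>S. eval_mpoly id (Poly_Mapping.lookup F) Q = 0}"
    show "F \<in> ?O"
    proof (rule ccontr)
      assume "F \<notin> ?O"
      then have "?w (Poly_Mapping.lookup F) \<notin> E"
        by (simp only: E not_False_eq_True)
      from zclosedD[OF closed this] obtain P where
        P: "P \<in> vanishing E" "P (?w (Poly_Mapping.lookup F)) \<noteq> 0"
        by (rule bexE)
      \<comment> \<open>Restricting the separating function to the embedded space gives a polynomial
        in the coefficients alone, hence a member of \<open>S\<close>.\<close>
      have "polyfun (\<lambda>v. P (?w v))"
      proof (rule polyfun_compose[where f = P and g = ?w])
        show "polyfun P"
          using P(1) by (simp add: vanishing_def)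
        show "polyfun (\<lambda>v. ?w v i)" for i
          by (cases i) (simp_all add: polyfun.const polyfun.var)
      qed
      then obtain Q where Q: "\<And>v. eval_mpoly id v Q = P (?w v)"
        using polyfun_imp_mpoly by blast
      have "P (?w (Poly_Mapping.lookup G)) = 0" if "G \<in> ?O" for G
        using P(1) that unfolding E[symmetric] vanishing_def by simp
      then have "Q \<in> S"
        by (auto simp: S_def Q)
      then show False
        using F P(2) by (auto simp: Q)
    qed
  qed
  then show ?thesis
    unfolding zariski_closed_in_quintics_def by blast
qed

theorem proposition32:
  fixes f :: "(5, complex) mpoly"
  assumes "f \<in> quintic_forms"
    and "\<exists>A. invertible A \<and> act A f = Var 0 * Var 1 * Var 2 * Var 3 * Var 4"
  shows "has_closed_orbit f"
proof -
  obtain A B where A: "act A f = Var 0 * Var 1 * Var 2 * Var 3 * Var 4" and AB: "A ** B = mat 1" "B ** A = mat 1"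
    using assms(2) unfolding invertible_def by blast
  have det: "det A * det B = 1"
    using arg_cong[OF AB(1), of det] by (simp add: Determinants.det_mul)
  have f: "f = form_product B"
    using act_act[of B A f] by (simp add: A AB act_mat_1 act_monomial)
  have act_fp: "act M (form_product B) = form_product (M ** B)" for M
    using act_act[of M B] by (simp flip: act_monomial)
  \<comment> \<open>Since \<open>f\<close> is \<open>form_product B\<close>, the orbit runs over the
    matrices \<open>M ** B\<close> with \<open>det M = 1\<close>; conversely \<open>C\<close> is
    reached by \<open>M = C ** A\<close>, as \<open>A\<close> inverts \<open>B\<close>.\<close>
  have "SL_orbit f = {form_product C | C. det C = det B}"
    unfolding SL_orbit_def f act_fp
  proof (intro equalityI subsetI)
    fix F :: form5
    assume "F \<in> {form_product (M ** B) | M. det M = 1}"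
    then obtain M where "F = form_product (M ** B)" "det M = 1"
      by blast
    then show "F \<in> {form_product C | C. det C = det B}"
      by (intro CollectI exI[of _ "M ** B"]) (simp add: Determinants.det_mul)
  next
    fix F :: form5
    assume "F \<in> {form_product C | C. det C = det B}"
    then obtain C where C: "F = form_product C" "det C = det B"
      by blast
    have "F = form_product ((C ** A) ** B)"
      by (simp add: C(1) matrix_mul_assoc[symmetric] AB)
    moreover have "det (C ** A) = 1"
      using det C(2) by (simp add: Determinants.det_mul mult.commute)
    ultimately show "F \<in> {form_product (M ** B) | M. det M = 1}"
      by blast
  qed
  moreover have "det B \<noteq> 0"
    using det by auto
  ultimately show ?thesis
    unfolding has_closed_orbit_def by (simp add: zariski_closed_form_products)
qed

end
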